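(* Let $\mathfrak g$ and $\mathfrak h$ be Leibniz algebras. (1) Let $\hat{\mathfrak g}=(\mathfrak g\oplus\mathfrak h,[\cdot,\cdot]_{(l,r,\omega)})$ be a non-abelian extension of $\mathfrak g$ by $\mathfrak h$ with $\mathrm Z(\mathfrak h)=\mathrm Z(\hat{\mathfrak g})\cap\mathfrak h$. Then $(l,r,\omega)$ gives rise to a Leibniz 2-algebra morphism $(f_0,f_1,f_2)$ from $\mathfrak g$ to the strict Leibniz 2-algebra $(\mathfrak h,\Xi(\mathfrak h),(\mathrm{ad}^L,\mathrm{ad}^R),l_2)$, where $$f_0(x)=(l_x,r_x),\quad f_1=0,\quad f_2(x,y)=\omega(x,y).$$ (2) Conversely, for any morphism $(f_0,f_1,f_2)$ from $\mathfrak g$ to $(\mathfrak h,\Xi(\mathfrak h),(\mathrm{ad}^L,\mathrm{ad}^R),l_2)$, there is a non-abelian extension $\hat{\mathfrak g}=(\mathfrak g\oplus\mathfrak h,[\cdot,\cdot]_{(l,r,\omega)})$ of $\mathfrak g$ by $\mathfrak h$ with $\mathrm Z(\mathfrak h)=\mathrm Z(\hat{\mathfrak g})\cap\mathfrak h$, where $$l_x=\mathrm{Pr}_Lf_0(x),\quad r_x=\mathrm{Pr}_Rf_0(x),\quad \omega(x,y)=f_2(x,y).$$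
   Context: All vector spaces are over a fixed ground field. A (left) Leibniz algebra is a vector space $\mathfrak g$ with a bilinear bracket satisfying $[x,[y,z]_{\mathfrak g}]_{\mathfrak g}=[[x,y]_{\mathfrak g},z]_{\mathfrak g}+[y,[x,z]_{\mathfrak g}]_{\mathfrak g}$. Its left center is $\mathrm Z(\mathfrak g)=\{x\in\mathfrak g:[x,y]_{\mathfrak g}=0\ \forall y\in\mathfrak g\}$. $\mathrm{ad}^L_x(y)=[x,y]$, $\mathrm{ad}^R_x(y)=[y,x]$. Extensions: for linear maps $l,r:\mathfrak g\to\mathfrak{gl}(\mathfrak h)$ and $\omega:\mathfrak g\otimes\mathfrak g\to\mathfrak h$, define on $\mathfrak g\oplus\mathfrak h$ the bracket $[x+\alpha,y+\beta]_{(l,r,\omega)}=[x,y]_{\mathfrak g}+\omega(x,y)+l_x\beta+r_y\alpha+[\alpha,\beta]_{\mathfrak h}$ ($x,y\in\mathfrak g$, $\alpha,\beta\in\mathfrak h$). When this is a Leibniz bracket, $\hat{\mathfrak g}=(\mathfrak g\oplus\mathfrak h,[\cdot,\cdot]_{(l,r,\omega)})$ is a non-abelian extension of $\mathfrak g$ by $\mathfrak h$, i.e. $0\to\mathfrak h\to\hat{\mathfrak g}\to\mathfrak g\to0$ (inclusion and projection) is a short exact sequence of Leibniz algebras. Derivations: $\mathrm{Der}^L(\mathfrak h)=\{D\in\mathfrak{gl}(\mathfrak h): D[\alpha,\beta]_{\mathfrak h}=[D\alpha,\beta]_{\mathfrak h}+[\alpha,D\beta]_{\mathfrak h}\}$,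 $\mathrm{Der}^R(\mathfrak h)=\{D\in\mathfrak{gl}(\mathfrak h): D[\alpha,\beta]_{\mathfrak h}=[\alpha,D\beta]_{\mathfrak h}-[\beta,D\alpha]_{\mathfrak h}\}$, $\mathfrak{Der}(\mathfrak h)=\mathrm{Der}^L(\mathfrak h)\oplus\mathrm{Der}^R(\mathfrak h)$ with Leibniz bracket $[(D^L_1,D^R_1),(D^L_2,D^R_2)]_s=([D^L_1,D^L_2],[D^L_1,D^R_2])$ (commutators), and projections $\mathrm{Pr}_L(D^L,D^R)=D^L$, $\mathrm{Pr}_R(D^L,D^R)=D^R$. Define $\Xi(\mathfrak h)=\{(D^L,D^R)\in\mathfrak{Der}(\mathfrak h): D^L\alpha+D^R\alpha\in\mathrm Z(\mathfrak h)\ \forall\alpha\in\mathfrak h,\text{ and }D^R\mathrm Z(\mathfrak h)=0\}$, a Leibniz subalgebra of $\mathfrak{Der}(\mathfrak h)$ containing all $(\mathrm{ad}^L_\alpha,\mathrm{ad}^R_\alpha)$. A Leibniz 2-algebra $(V_1,V_0,\mathrm d,l_2,l_3)$ consists of a linear map $\mathrm d:V_1\to V_0$, bilinear maps $l_2:V_i\times V_j\to V_{i+j}$ ($0\le i+j\le1$) and a trilinear map $l_3:V_0^{3}\to V_1$ such that for $w,x,y,z\in V_0$, $m,n\in V_1$: (a) $\mathrm dl_2(x,m)=l_2(x,\mathrm dm)$; (b) $\mathrm dl_2(m,x)=l_2(\mathrm dm,x)$; (c) $l_2(\mathrm dm,n)=l_2(m,\mathrm dn)$; (d) $\mathrm dl_3(x,y,z)=l_2(x,l_2(y,z))-l_2(l_2(x,y),z)-l_2(y,l_2(x,z))$;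 (e1) $l_3(x,y,\mathrm dm)=l_2(x,l_2(y,m))-l_2(l_2(x,y),m)-l_2(y,l_2(x,m))$; (e2) $l_3(x,\mathrm dm,y)=l_2(x,l_2(m,y))-l_2(l_2(x,m),y)-l_2(m,l_2(x,y))$; (e3) $l_3(\mathrm dm,x,y)=l_2(m,l_2(x,y))-l_2(l_2(m,x),y)-l_2(x,l_2(m,y))$; (f) $l_2(w,l_3(x,y,z))-l_2(x,l_3(w,y,z))+l_2(y,l_3(w,x,z))+l_2(l_3(w,x,y),z)-l_3(l_2(w,x),y,z)-l_3(x,l_2(w,y),z)-l_3(x,y,l_2(w,z))+l_3(w,l_2(x,y),z)+l_3(w,y,l_2(x,z))-l_3(w,x,l_2(y,z))=0$. It is strict if $l_3=0$ (then $l_3$ is omitted from the notation). A Leibniz algebra $\mathfrak g$ is viewed as the Leibniz 2-algebra with $V_1=0$, $V_0=\mathfrak g$, $l_2=[\cdot,\cdot]_{\mathfrak g}$, $l_3=0$. The strict Leibniz 2-algebra $(\mathfrak h,\Xi(\mathfrak h),(\mathrm{ad}^L,\mathrm{ad}^R),l_2)$ has $V_1=\mathfrak h$, $V_0=\Xi(\mathfrak h)$, $\mathrm d\alpha=(\mathrm{ad}^L_\alpha,\mathrm{ad}^R_\alpha)$, $l_2=[\cdot,\cdot]_s$ on $\Xi(\mathfrak h)$, $l_2((D^L,D^R),\alpha)=D^L\alpha$, $l_2(\alpha,(D^L,D^R))=D^R\alpha$. A morphism of Leibniz 2-algebras from $\mathcal V$ to $\mathcal V'$ consists of linear maps $f_0:V_0\to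 V_0'$, $f_1:V_1\to V_1'$ with $f_0\circ\mathrm d=\mathrm d'\circ f_1$ and a bilinear map $f_2:V_0\times V_0\to V_1'$ such that for $x,y,z\in V_0$, $m\in V_1$: $l_2'(f_0(x),f_0(y))-f_0l_2(x,y)=\mathrm d'f_2(x,y)$; $l_2'(f_0(x),f_1(m))-f_1l_2(x,m)=f_2(x,\mathrm dm)$; $l_2'(f_1(m),f_0(x))-f_1l_2(m,x)=f_2(\mathrm dm,x)$; and $f_1(l_3(x,y,z))+l_2'(f_0(x),f_2(y,z))-l_2'(f_0(y),f_2(x,z))-l_2'(f_2(x,y),f_0(z))-f_2(l_2(x,y),z)+f_2(x,l_2(y,z))-f_2(y,l_2(x,z))-l_3'(f_0(x),f_0(y),f_0(z))=0$. *)

theory Defs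
  imports "HOL-Library.Function_Algebras" "HOL-Analysis.Product_Vector"
begin

section \<open>Linear and multilinear maps between subspaces\<close>

text \<open>A vector space is a subspace \<open>V\<close> of an ambient space given by a type and a
  scalar multiplication; the ambient space itself is \<open>UNIV\<close>. Carriers other than \<open>UNIV\<close> are
  needed because the degree zero part \<open>\<Xi>(\<hh>)\<close> of the target 2-algebra is not a whole type.
  Maps are only constrained on the carriers.\<close>

definition linear_on ::
  "('k \<Rightarrow> 'a::plus \<Rightarrow> 'a) \<Rightarrow> 'a set \<Rightarrow> ('k \<Rightarrow> 'b::plus \<Rightarrow> 'b) \<Rightarrow> 'b set \<Rightarrow> ('a \<Rightarrow> 'b) \<Rightarrow> bool"
  where "linear_on s V t W f \<longleftrightarrow>
    (\<forall>x\<in>V. f x \<in> W) \<and>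
    (\<forall>x\<in>V. \<forall>y\<in>V. f (x + y) = f x + f y) \<and>
    (\<forall>c. \<forall>x\<in>V. f (s c x) = t c (f x))"

definition bilinear_on ::
  "('k \<Rightarrow> 'a::plus \<Rightarrow> 'a) \<Rightarrow> 'a set \<Rightarrow> ('k \<Rightarrow> 'b::plus \<Rightarrow> 'b) \<Rightarrow> 'b set \<Rightarrow>
   ('k \<Rightarrow> 'c::plus \<Rightarrow> 'c) \<Rightarrow> 'c set \<Rightarrow> ('a \<Rightarrow> 'b \<Rightarrow> 'c) \<Rightarrow> bool"
  where "bilinear_on s V t W u U B \<longleftrightarrow>
    (\<forall>y\<in>W. linear_on s V u U (\<lambda>x. B x y)) \<and>
    (\<forall>x\<in>V. linear_on t W u U (\<lambda>y. B x y))"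

definition trilinear_on ::
  "('k \<Rightarrow> 'a::plus \<Rightarrow> 'a) \<Rightarrow> 'a set \<Rightarrow> ('k \<Rightarrow> 'b::plus \<Rightarrow> 'b) \<Rightarrow> 'b set \<Rightarrow>
   ('a \<Rightarrow> 'a \<Rightarrow> 'a \<Rightarrow> 'b) \<Rightarrow> bool"
  where "trilinear_on s V u U T \<longleftrightarrow>
    (\<forall>y\<in>V. \<forall>z\<in>V. linear_on s V u U (\<lambda>x. T x y z)) \<and>
    (\<forall>x\<in>V. \<forall>z\<in>V. linear_on s V u U (\<lambda>y. T x y z)) \<and>
    (\<forall>x\<in>V. \<forall>y\<in>V. linear_on s V u U (\<lambda>z. T x y z))"

definition fun_scale :: "('k \<Rightarrow> 'b \<Rightarrow> 'b) \<Rightarrow> 'k \<Rightarrow> ('a \<Rightarrow> 'b) \<Rightarrow> 'a \<Rightarrow> 'b"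
  where "fun_scale s c f = (\<lambda>x. s c (f x))"

definition gl :: "('k::field \<Rightarrow> 'a::ab_group_add \<Rightarrow> 'a) \<Rightarrow> ('a \<Rightarrow> 'a) set"
  where "gl s = {D. Vector_Spaces.linear s s D}"


section \<open>Leibniz algebras\<close>

locale leibniz_algebra = vector_space scale
  for scale :: "'k::field \<Rightarrow> 'a::ab_group_add \<Rightarrow> 'a" +
  fixes br :: "'a \<Rightarrow> 'a \<Rightarrow> 'a"
  assumes bilinear_br: "bilinear_on scale UNIV scale UNIV scale UNIV br"
    and leibniz: "br x (br y z) = br (br x y) z + br y (br x z)"

definition left_center :: "('a \<Rightarrow> 'a \<Rightarrow> 'a::zero) \<Rightarrow> 'a set"
  where "left_center br = {x. \<forall>y. br x y = 0}"

definition adL :: "('a \<Rightarrow> 'a \<Rightarrow> 'a) \<Rightarrow> 'a \<Rightarrow> 'a \<Rightarrow> 'a"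
  where "adL br x = (\<lambda>y. br x y)"

definition adR :: "('a \<Rightarrow> 'a \<Rightarrow> 'a) \<Rightarrow> 'a \<Rightarrow> 'a \<Rightarrow> 'a"
  where "adR br x = (\<lambda>y. br y x)"


section \<open>Non-abelian extensions\<close>

definition ext_br ::
  "('g \<Rightarrow> 'g \<Rightarrow> 'g) \<Rightarrow> ('h \<Rightarrow> 'h \<Rightarrow> 'h::plus) \<Rightarrow> ('g \<Rightarrow> 'h \<Rightarrow> 'h) \<Rightarrow> ('g \<Rightarrow> 'h \<Rightarrow> 'h) \<Rightarrow>
   ('g \<Rightarrow> 'g \<Rightarrow> 'h) \<Rightarrow> 'g \<times> 'h \<Rightarrow> 'g \<times> 'h \<Rightarrow> 'g \<times> 'h"
  where "ext_br bg bh l r \<omega> = (\<lambda>(x, \<alpha>) (y, \<beta>). (bg x y, \<omega> x y + l x \<beta> + r y \<alpha> + bh \<alpha> \<beta>))"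

locale nonabelian_extension =
  G: leibniz_algebra sg bg +
  H: leibniz_algebra sh bh +
  E: leibniz_algebra "module_prod.scale sg sh" "ext_br bg bh l r \<omega>"
  for sg :: "'k::field \<Rightarrow> 'g::ab_group_add \<Rightarrow> 'g" and bg :: "'g \<Rightarrow> 'g \<Rightarrow> 'g"
    and sh :: "'k \<Rightarrow> 'h::ab_group_add \<Rightarrow> 'h" and bh :: "'h \<Rightarrow> 'h \<Rightarrow> 'h"
    and l r :: "'g \<Rightarrow> 'h \<Rightarrow> 'h" and \<omega> :: "'g \<Rightarrow> 'g \<Rightarrow> 'h" +
  assumes linear_l: "linear_on sg UNIV (fun_scale sh) (gl sh) l"
    and linear_r: "linear_on sg UNIV (fun_scale sh) (gl sh) r"
    and bilinear_\<omega>: "bilinear_on sg UNIV sg UNIV sh UNIV \<omega>"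


section \<open>Leibniz 2-algebras and their morphisms\<close>

text \<open>The bracket \<open>l\<^sub>2\<close> is split into its components on \<open>V\<^sub>0 \<times> V\<^sub>0\<close>,
  \<open>V\<^sub>0 \<times> V\<^sub>1\<close> and \<open>V\<^sub>1 \<times> V\<^sub>0\<close>; there is none on \<open>V\<^sub>1 \<times> V\<^sub>1\<close>.\<close>

record ('k, 'a, 'b) two_alg =
  scl0 :: "'k \<Rightarrow> 'a \<Rightarrow> 'a"
  car0 :: "'a set"
  scl1 :: "'k \<Rightarrow> 'b \<Rightarrow> 'b"
  car1 :: "'b set"
  dd :: "'b \<Rightarrow> 'a"
  l00 :: "'a \<Rightarrow> 'a \<Rightarrow> 'a"
  l01 :: "'a \<Rightarrow> 'b \<Rightarrow> 'b"
  l10 :: "'b \<Rightarrow> 'a \<Rightarrow> 'b"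
  l3 :: "'a \<Rightarrow> 'a \<Rightarrow> 'a \<Rightarrow> 'b"

locale leibniz_2_algebra =
  vs0: vector_space "scl0 V" + vs1: vector_space "scl1 V"
  for V :: "('k::field, 'a::ab_group_add, 'b::ab_group_add) two_alg" +
  assumes subspace0: "vs0.subspace (car0 V)"
    and subspace1: "vs1.subspace (car1 V)"
    and linear_dd: "linear_on (scl1 V) (car1 V) (scl0 V) (car0 V) (dd V)"
    and bilinear_l00: "bilinear_on (scl0 V) (car0 V) (scl0 V) (car0 V) (scl0 V) (car0 V) (l00 V)"
    and bilinear_l01: "bilinear_on (scl0 V) (car0 V) (scl1 V) (car1 V) (scl1 V) (car1 V) (l01 V)"
    and bilinear_l10: "bilinear_on (scl1 V) (car1 V) (scl0 V) (car0 V) (scl1 V) (car1 V) (l10 V)"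
    and trilinear_l3: "trilinear_on (scl0 V) (car0 V) (scl1 V) (car1 V) (l3 V)"
    and axiom_a: "\<lbrakk>x \<in> car0 V; m \<in> car1 V\<rbrakk> \<Longrightarrow> dd V (l01 V x m) = l00 V x (dd V m)"
    and axiom_b: "\<lbrakk>x \<in> car0 V; m \<in> car1 V\<rbrakk> \<Longrightarrow> dd V (l10 V m x) = l00 V (dd V m) x"
    and axiom_c: "\<lbrakk>m \<in> car1 V; n \<in> car1 V\<rbrakk> \<Longrightarrow> l01 V (dd V m) n = l10 V m (dd V n)"
    and axiom_d: "\<lbrakk>x \<in> car0 V; y \<in> car0 V; z \<in> car0 V\<rbrakk> \<Longrightarrow>
      dd V (l3 V x y z) = l00 V x (l00 V y z) - l00 V (l00 V x y) z - l00 V y (l00 V x z)"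
    and axiom_e1: "\<lbrakk>x \<in> car0 V; y \<in> car0 V; m \<in> car1 V\<rbrakk> \<Longrightarrow>
      l3 V x y (dd V m) = l01 V x (l01 V y m) - l01 V (l00 V x y) m - l01 V y (l01 V x m)"
    and axiom_e2: "\<lbrakk>x \<in> car0 V; y \<in> car0 V; m \<in> car1 V\<rbrakk> \<Longrightarrow>
      l3 V x (dd V m) y = l01 V x (l10 V m y) - l10 V (l01 V x m) y - l10 V m (l00 V x y)"
    and axiom_e3: "\<lbrakk>x \<in> car0 V; y \<in> car0 V; m \<in> car1 V\<rbrakk> \<Longrightarrow>
      l3 V (dd V m) x y = l10 V m (l00 V x y) - l10 V (l10 V m x) y - l01 V x (l10 V m y)"
    and axiom_f: "\<lbrakk>w \<in> car0 V; x \<in> car0 V; y \<in> car0 V; z \<in> car0 V\<rbrakk> \<Longrightarrow>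
      l01 V w (l3 V x y z) - l01 V x (l3 V w y z) + l01 V y (l3 V w x z) + l10 V (l3 V w x y) z
      - l3 V (l00 V w x) y z - l3 V x (l00 V w y) z - l3 V x y (l00 V w z)
      + l3 V w (l00 V x y) z + l3 V w y (l00 V x z) - l3 V w x (l00 V y z) = 0"

locale strict_leibniz_2_algebra = leibniz_2_algebra V
  for V :: "('k::field, 'a::ab_group_add, 'b::ab_group_add) two_alg" +
  assumes strict: "\<lbrakk>x \<in> car0 V; y \<in> car0 V; z \<in> car0 V\<rbrakk> \<Longrightarrow> l3 V x y z = 0"

locale leibniz_2_morphism =
  source: leibniz_2_algebra V + target: leibniz_2_algebra W
  for V :: "('k::field, 'a::ab_group_add, 'b::ab_group_add) two_alg"
    and W :: "('k, 'c::ab_group_add, 'd::ab_group_add) two_alg"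
    and f0 :: "'a \<Rightarrow> 'c" and f1 :: "'b \<Rightarrow> 'd" and f2 :: "'a \<Rightarrow> 'a \<Rightarrow> 'd" +
  assumes linear_f0: "linear_on (scl0 V) (car0 V) (scl0 W) (car0 W) f0"
    and linear_f1: "linear_on (scl1 V) (car1 V) (scl1 W) (car1 W) f1"
    and bilinear_f2: "bilinear_on (scl0 V) (car0 V) (scl0 V) (car0 V) (scl1 W) (car1 W) f2"
    and chain_map: "m \<in> car1 V \<Longrightarrow> f0 (dd V m) = dd W (f1 m)"
    and hom_l00: "\<lbrakk>x \<in> car0 V; y \<in> car0 V\<rbrakk> \<Longrightarrow>
      l00 W (f0 x) (f0 y) - f0 (l00 V x y) = dd W (f2 x y)"
    and hom_l01: "\<lbrakk>x \<in> car0 V; m \<in> car1 V\<rbrakk> \<Longrightarrow>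
      l01 W (f0 x) (f1 m) - f1 (l01 V x m) = f2 x (dd V m)"
    and hom_l10: "\<lbrakk>x \<in> car0 V; m \<in> car1 V\<rbrakk> \<Longrightarrow>
      l10 W (f1 m) (f0 x) - f1 (l10 V m x) = f2 (dd V m) x"
    and coherence: "\<lbrakk>x \<in> car0 V; y \<in> car0 V; z \<in> car0 V\<rbrakk> \<Longrightarrow>
      f1 (l3 V x y z) + l01 W (f0 x) (f2 y z) - l01 W (f0 y) (f2 x z) - l10 W (f2 x y) (f0 z)
      - f2 (l00 V x y) z + f2 x (l00 V y z) - f2 y (l00 V x z) - l3 W (f0 x) (f0 y) (f0 z) = 0"

text \<open>The zero space \<open>V\<^sub>1\<close> is realised as \<open>{0}\<close> inside the type of the Leibniz algebra.\<close>

definition alg_two_alg ::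
  "('k \<Rightarrow> 'g::ab_group_add \<Rightarrow> 'g) \<Rightarrow> ('g \<Rightarrow> 'g \<Rightarrow> 'g) \<Rightarrow> ('k, 'g, 'g) two_alg"
  where "alg_two_alg s br =
    \<lparr>scl0 = s, car0 = UNIV, scl1 = s, car1 = {0}, dd = (\<lambda>_. 0),
     l00 = br, l01 = (\<lambda>_ _. 0), l10 = (\<lambda>_ _. 0), l3 = (\<lambda>_ _ _. 0)\<rparr>"


section \<open>Derivations and the strict 2-algebra of \<open>\<hh>\<close>\<close>

definition DerL ::
  "('k::field \<Rightarrow> 'h::ab_group_add \<Rightarrow> 'h) \<Rightarrow> ('h \<Rightarrow> 'h \<Rightarrow> 'h) \<Rightarrow> ('h \<Rightarrow> 'h) set"
  where "DerL s br = {D \<in> gl s. \<forall>\<alpha> \<beta>. D (br \<alpha> \<beta>) = br (D \<alpha>) \<beta> + br \<alpha> (D \<beta>)}"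

definition DerR ::
  "('k::field \<Rightarrow> 'h::ab_group_add \<Rightarrow> 'h) \<Rightarrow> ('h \<Rightarrow> 'h \<Rightarrow> 'h) \<Rightarrow> ('h \<Rightarrow> 'h) set"
  where "DerR s br = {D \<in> gl s. \<forall>\<alpha> \<beta>. D (br \<alpha> \<beta>) = br \<alpha> (D \<beta>) - br \<beta> (D \<alpha>)}"

definition Der ::
  "('k::field \<Rightarrow> 'h::ab_group_add \<Rightarrow> 'h) \<Rightarrow> ('h \<Rightarrow> 'h \<Rightarrow> 'h) \<Rightarrow> (('h \<Rightarrow> 'h) \<times> ('h \<Rightarrow> 'h)) set"
  where "Der s br = DerL s br \<times> DerR s br"

abbreviation Pr_L :: "('h \<Rightarrow> 'h) \<times> ('h \<Rightarrow> 'h) \<Rightarrow> 'h \<Rightarrow> 'h"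
  where "Pr_L \<equiv> fst"

abbreviation Pr_R :: "('h \<Rightarrow> 'h) \<times> ('h \<Rightarrow> 'h) \<Rightarrow> 'h \<Rightarrow> 'h"
  where "Pr_R \<equiv> snd"

definition commutator :: "('h \<Rightarrow> 'h::minus) \<Rightarrow> ('h \<Rightarrow> 'h) \<Rightarrow> 'h \<Rightarrow> 'h"
  where "commutator D D' = (\<lambda>\<alpha>. D (D' \<alpha>) - D' (D \<alpha>))"

definition der_br ::
  "('h \<Rightarrow> 'h::minus) \<times> ('h \<Rightarrow> 'h) \<Rightarrow> ('h \<Rightarrow> 'h) \<times> ('h \<Rightarrow> 'h) \<Rightarrow> ('h \<Rightarrow> 'h) \<times> ('h \<Rightarrow> 'h)"
  where "der_br D D' = (commutator (Pr_L D) (Pr_L D'), commutator (Pr_L D) (Pr_R D'))"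

definition Xi ::
  "('k::field \<Rightarrow> 'h::ab_group_add \<Rightarrow> 'h) \<Rightarrow> ('h \<Rightarrow> 'h \<Rightarrow> 'h) \<Rightarrow> (('h \<Rightarrow> 'h) \<times> ('h \<Rightarrow> 'h)) set"
  where "Xi s br = {D \<in> Der s br.
    (\<forall>\<alpha>. Pr_L D \<alpha> + Pr_R D \<alpha> \<in> left_center br) \<and> (\<forall>\<alpha>\<in>left_center br. Pr_R D \<alpha> = 0)}"

definition Xi_two_alg ::
  "('k::field \<Rightarrow> 'h::ab_group_add \<Rightarrow> 'h) \<Rightarrow> ('h \<Rightarrow> 'h \<Rightarrow> 'h) \<Rightarrow>
   ('k, ('h \<Rightarrow> 'h) \<times> ('h \<Rightarrow> 'h), 'h) two_alg"
  where "Xi_two_alg s br =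
    \<lparr>scl0 = module_prod.scale (fun_scale s) (fun_scale s), car0 = Xi s br,
     scl1 = s, car1 = UNIV, dd = (\<lambda>\<alpha>. (adL br \<alpha>, adR br \<alpha>)),
     l00 = der_br, l01 = (\<lambda>D \<alpha>. Pr_L D \<alpha>), l10 = (\<lambda>\<alpha> D. Pr_R D \<alpha>), l3 = (\<lambda>_ _ _. 0)\<rparr>"


section \<open>Well-definedness\<close>

lemma vector_space_fun_scale:
  assumes "vector_space s" shows "vector_space (fun_scale s)"
proof -
  interpret vector_space s by fact
  show ?thesis
    by unfold_locales (auto simp: fun_scale_def scale_right_distrib scale_left_distrib fun_eq_iff)
qed

lemma module_prod_vector_space:
  assumes "vector_space s" "vector_space t" shows "module_prod s t"
  using assms by (simp add: module_prod_def module_pair_def module_iff_vector_space)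

lemma vector_space_module_prod:
  assumes "vector_space s" "vector_space t" shows "vector_space (module_prod.scale s t)"
proof -
  interpret vector_space_prod s t
    using assms by (simp add: vector_space_prod_def vector_space_pair_def)
  show ?thesis by (rule p.vector_space_axioms)
qed

lemma (in nonabelian_extension) short_exact:
  "linear_on sh UNIV (module_prod.scale sg sh) UNIV (Pair 0)"
  "linear_on (module_prod.scale sg sh) UNIV sg UNIV fst"
  "Pair 0 (bh \<alpha> \<beta>) = ext_br bg bh l r \<omega> (Pair 0 \<alpha>) (Pair 0 \<beta>)"
  "fst (ext_br bg bh l r \<omega> u v) = bg (fst u) (fst v)"
  "inj (Pair (0::'g) :: 'h \<Rightarrow> 'g \<times> 'h)"
  "surj (fst :: 'g \<times> 'h \<Rightarrow> 'g)"
  "range (Pair (0::'g) :: 'h \<Rightarrow> 'g \<times> 'h) = {u. fst u = 0}"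
proof -
  note sc = module_prod.scale_def[OF module_prod_vector_space[OF G.vector_space_axioms H.vector_space_axioms]]
  show "linear_on sh UNIV (module_prod.scale sg sh) UNIV (Pair 0)"
    "linear_on (module_prod.scale sg sh) UNIV sg UNIV fst"
    by (auto simp: linear_on_def sc)
  have hom0: "f 0 = 0" if "\<And>x y. f (x + y) = f x + f y"
    for f :: "'x::ab_group_add \<Rightarrow> 'y::ab_group_add"
    using that[of 0 0] by simp
  have b0: "bg 0 0 = 0" "\<omega> 0 0 = 0"
    using G.bilinear_br bilinear_\<omega> hom0[of "\<lambda>x. bg x 0"] hom0[of "\<lambda>x. \<omega> x 0"]
    by (auto simp: bilinear_on_def linear_on_def)
  have "l 0 = 0" "r 0 = 0"
    using linear_l linear_r hom0[of l] hom0[of r] by (auto simp: linear_on_def)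
  then show "Pair 0 (bh \<alpha> \<beta>) = ext_br bg bh l r \<omega> (Pair 0 \<alpha>) (Pair 0 \<beta>)"
    by (simp add: ext_br_def b0)
  show "fst (ext_br bg bh l r \<omega> u v) = bg (fst u) (fst v)"
    by (simp add: ext_br_def split_beta)
  show "inj (Pair (0::'g) :: 'h \<Rightarrow> 'g \<times> 'h)" "surj (fst :: 'g \<times> 'h \<Rightarrow> 'g)"
    "range (Pair (0::'g) :: 'h \<Rightarrow> 'g \<times> 'h) = {u. fst u = 0}"
    by (auto simp: inj_def image_iff)
qed

context leibniz_algebra
begin

lemma br_simps:
  "br (x + y) z = br x z + br y z" "br x (y + z) = br x y + br x z"
  "br (scale c x) y = scale c (br x y)" "br x (scale c y) = scale c (br x y)"
  using bilinear_br by (auto simp: bilinear_on_def linear_on_def)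

lemma br_zero: "br 0 y = 0" "br x 0 = 0"
  using br_simps(1)[of 0 0 y] br_simps(2)[of x 0 0] by simp_all

lemma br_diff: "br (x - y) z = br x z - br y z" "br x (y - z) = br x y - br x z"
  using br_simps(1)[of "x - y" y z] br_simps(2)[of x "y - z" z] by (simp_all add: algebra_simps)

lemma br_br: "br (br x y) z = br x (br y z) - br y (br x z)"
  by (simp add: leibniz[of x y z])

lemma gl_iff:
  "D \<in> gl scale \<longleftrightarrow> (\<forall>x y. D (x + y) = D x + D y) \<and> (\<forall>c x. D (scale c x) = scale c (D x))"
  by (auto simp: gl_def Vector_Spaces.linear_iff vector_space_axioms)

lemma gl_diff: "D \<in> gl scale \<Longrightarrow> D (x - y) = D x - D y"
  by (metis gl_iff diff_add_cancel eq_diff_eq)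

lemma gl_zero: "D \<in> gl scale \<Longrightarrow> D 0 = 0"
  using gl_diff[of D 0 0] by simp

lemma strict_leibniz_2_algebra_alg_two_alg:
  "strict_leibniz_2_algebra (alg_two_alg scale br)"
  unfolding alg_two_alg_def
  by unfold_locales
    (auto simp: linear_on_def bilinear_on_def trilinear_on_def br_simps br_zero br_br
      scale_right_distrib scale_left_distrib subspace_def)

lemma Xi_iff:
  "D \<in> Xi scale br \<longleftrightarrow> fst D \<in> gl scale \<and> snd D \<in> gl scale \<and>
    (\<forall>\<alpha> \<beta>. fst D (br \<alpha> \<beta>) = br (fst D \<alpha>) \<beta> + br \<alpha> (fst D \<beta>)) \<and>
    (\<forall>\<alpha> \<beta>. snd D (br \<alpha> \<beta>) = br \<alpha> (snd D \<beta>) - br \<beta> (snd D \<alpha>)) \<and>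
    (\<forall>\<alpha> \<beta>. br (snd D \<alpha>) \<beta> = - br (fst D \<alpha>) \<beta>) \<and>
    (\<forall>\<alpha>. (\<forall>\<beta>. br \<alpha> \<beta> = 0) \<longrightarrow> snd D \<alpha> = 0)"
  by (auto simp: Xi_def Der_def DerL_def DerR_def left_center_def br_simps
      eq_neg_iff_add_eq_0 add.commute mem_Times_iff)

lemma Xi_snd_sum:
  assumes "D \<in> Xi scale br" "E \<in> Xi scale br"
  shows "snd E (snd D \<alpha>) = - snd E (fst D \<alpha>)"
proof -
  have "snd E (fst D \<alpha> + snd D \<alpha>) = 0"
    using assms by (auto simp: Xi_iff br_simps)
  then show ?thesis
    using assms(2) by (auto simp: Xi_iff gl_iff eq_neg_iff_add_eq_0 add.commute)
qed

lemma Xi_closed: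
  assumes D: "D \<in> Xi scale br" and E: "E \<in> Xi scale br"
  shows "der_br D E \<in> Xi scale br"
proof -
  have lin: "fst D \<in> gl scale" "snd D \<in> gl scale" "fst E \<in> gl scale" "snd E \<in> gl scale"
    using D E by (auto simp: Xi_iff)
  note rules = lin[THEN gl_diff] lin[THEN gl_zero]
    lin[unfolded gl_iff, THEN conjunct1, rule_format]
    lin[unfolded gl_iff, THEN conjunct2, rule_format]
  have dist: "\<And>\<alpha> \<beta>. fst D (br \<alpha> \<beta>) = br (fst D \<alpha>) \<beta> + br \<alpha> (fst D \<beta>)"
    "\<And>\<alpha> \<beta>. fst E (br \<alpha> \<beta>) = br (fst E \<alpha>) \<beta> + br \<alpha> (fst E \<beta>)"
    "\<And>\<alpha> \<beta>. snd E (br \<alpha> \<beta>) = br \<alpha> (snd E \<beta>) - br \<beta> (snd E \<alpha>)"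
    and anti: "\<And>\<alpha> \<beta>. br (snd E \<alpha>) \<beta> = - br (fst E \<alpha>) \<beta>"
    and cent: "\<And>\<alpha>. (\<forall>\<beta>. br \<alpha> \<beta> = 0) \<Longrightarrow> snd E \<alpha> = 0"
    using D E by (auto simp: Xi_iff)
  have pres: "br (fst D \<alpha>) \<beta> = fst D (br \<alpha> \<beta>) - br \<alpha> (fst D \<beta>)" for \<alpha> \<beta>
    by (simp add: dist)
  have 1: "br (fst D (snd E \<alpha>)) \<beta> = - br (fst D (fst E \<alpha>)) \<beta>" for \<alpha> \<beta>
  proof -
    have "br (fst D (snd E \<alpha>)) \<beta> = fst D (- br (fst E \<alpha>) \<beta>) + br (fst E \<alpha>) (fst D \<beta>)"
      by (simp add: pres anti)
    also have "fst D (- br (fst E \<alpha>) \<beta>) = - fst D (br (fst E \<alpha>) \<beta>)"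
      using rules(1)[of 0 "br (fst E \<alpha>) \<beta>"] rules(5) by simp
    finally show ?thesis by (simp add: pres)
  qed
  have 2: "br (fst D \<alpha>) \<beta> = 0" if "\<forall>\<beta>. br \<alpha> \<beta> = 0" for \<alpha> \<beta>
    by (simp add: pres that rules)
  show ?thesis
    unfolding Xi_iff
  proof (intro conjI allI impI)
    show "fst (der_br D E) \<in> gl scale" "snd (der_br D E) \<in> gl scale"
      by (auto simp: der_br_def commutator_def gl_iff rules algebra_simps scale_right_diff_distrib)
  next
    fix \<alpha> \<beta>
    show "fst (der_br D E) (br \<alpha> \<beta>) = br (fst (der_br D E) \<alpha>) \<beta> + br \<alpha> (fst (der_br D E) \<beta>)"
      by (simp add: der_br_def commutator_def rules dist br_diff)
    show "snd (der_br D E) (br \<alpha> \<beta>) = br \<alpha> (snd (der_br D E) \<beta>) - br \<beta> (snd (der_br D E) \<alpha>)"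
      by (simp add: der_br_def commutator_def rules dist br_diff)
    show "br (snd (der_br D E) \<alpha>) \<beta> = - br (fst (der_br D E) \<alpha>) \<beta>"
      by (simp add: der_br_def commutator_def br_diff 1 anti)
  next
    fix \<alpha> assume "\<forall>\<beta>. br \<alpha> \<beta> = 0"
    then show "snd (der_br D E) \<alpha> = 0"
      using 2[of \<alpha>] cent[of \<alpha>] cent[of "fst D \<alpha>"] by (simp add: der_br_def commutator_def rules)
  qed
qed

lemma ad_in_Xi: "(adL br \<alpha>, adR br \<alpha>) \<in> Xi scale br"
  unfolding Xi_iff by (auto simp: gl_iff adL_def adR_def br_simps br_br)

lemma strict_leibniz_2_algebra_Xi:
  "strict_leibniz_2_algebra (Xi_two_alg scale br)"
proof -
  let ?S = "module_prod.scale (fun_scale scale) (fun_scale scale)"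
  note vf = vector_space_fun_scale[OF vector_space_axioms]
  note sc = module_prod.scale_def[OF module_prod_vector_space[OF vf vf]]
  interpret P: vector_space ?S by (rule vector_space_module_prod[OF vf vf])
  have sub: "P.subspace (Xi scale br)"
    unfolding P.subspace_def
  proof (intro conjI ballI allI)
    show "0 \<in> Xi scale br" by (auto simp: Xi_iff gl_iff br_zero)
  next
    fix D E assume "D \<in> Xi scale br" "E \<in> Xi scale br"
    then show "D + E \<in> Xi scale br"
      by (auto simp: Xi_iff gl_iff br_simps scale_right_distrib algebra_simps)
  next
    fix c D assume "D \<in> Xi scale br"
    then show "?S c D \<in> Xi scale br"
      by (auto simp: Xi_iff gl_iff br_simps sc fun_scale_def scale_right_distrib
          scale_right_diff_distrib scale_left_commute)
  qed
  have anti: "br (snd D x) y = - br (fst D x) y" if "D \<in> Xi scale br" for D x y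
    using that by (auto simp: Xi_iff)
  have dist: "fst D (br x y) = br (fst D x) y + br x (fst D y)"
    "snd D (br x y) = br x (snd D y) - br y (snd D x)" if "D \<in> Xi scale br" for D x y
    using that by (auto simp: Xi_iff)
  have lin: "fst D (x + y) = fst D x + fst D y" "snd D (x + y) = snd D x + snd D y"
    "fst D (scale c x) = scale c (fst D x)" "snd D (scale c x) = scale c (snd D x)"
    if "D \<in> Xi scale br" for D x y c
    using that by (auto simp: Xi_iff gl_iff)
  have gl: "fst D \<in> gl scale" "snd D \<in> gl scale" if "D \<in> Xi scale br" for D
    using that by (auto simp: Xi_iff)
  have ad: "(br x, \<lambda>y. br y x) \<in> Xi scale br" for x
    using ad_in_Xi by (simp add: adL_def adR_def)
  have closed: "(\<lambda>\<alpha>. a (a' \<alpha>) - a' (a \<alpha>), \<lambda>\<alpha>. a (b' \<alpha>) - b' (a \<alpha>)) \<in> Xi scale br"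
    if "(a, b) \<in> Xi scale br" "(a', b') \<in> Xi scale br" for a b a' b'
    using Xi_closed[OF that] by (simp add: der_br_def commutator_def)
  have zero: "fst D 0 = 0" "snd D 0 = 0" if "D \<in> Xi scale br" for D
    using gl[OF that] by (simp_all add: gl_zero)
  show ?thesis
    unfolding Xi_two_alg_def
    by unfold_locales
     (auto simp: sub linear_on_def bilinear_on_def trilinear_on_def ad closed br_zero Xi_snd_sum zero[of "(a, b)" for a b, simplified]
      sc fun_scale_def der_br_def commutator_def adL_def adR_def br_simps fun_eq_iff
      lin dist anti gl_diff[OF gl(1)] gl_diff[OF gl(2)] P.scale_right_distrib
      scale_right_distrib scale_left_distrib scale_right_diff_distrib subspace_def algebra_simps)
qed

end

end

theory Submission
  imports Defs
begin

text \<open>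
  Write an element of the extension as a sum \<open>x + \<alpha>\<close>. For linear \<open>l\<close>, \<open>r\<close> and bilinear
  \<open>\<omega>\<close>, both sides of the Leibniz identity are trilinear, so the identity may be tested on
  arguments lying in \<open>\<gg>\<close> or in \<open>\<hh>\<close>. Besides the two identities of \<open>\<gg>\<close> and \<open>\<hh>\<close> this leaves
  six mixed identities and the cocycle identity for \<open>\<omega>\<close> (\<open>leibniz_ext_br_iff\<close>).

  The three identities with one argument in \<open>\<gg>\<close> say that \<open>l\<^sub>x\<close> and \<open>r\<^sub>x\<close> are left and right
  derivations and that \<open>l\<^sub>x + r\<^sub>x\<close> maps into the left center of \<open>\<hh>\<close>. The condition on the
  left centers says exactly that \<open>r\<^sub>x\<close> kills the left center of \<open>\<hh>\<close>
  (\<open>left_center_ext_br_iff\<close>). Together these four facts are the membership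
  \<open>(l\<^sub>x, r\<^sub>x) \<in> \<Xi>(\<hh>)\<close>. Of the three identities with two arguments in \<open>\<gg>\<close>, two say that
  \<open>(l, r)\<close> preserves brackets up to the inner pair \<open>(ad\<^sup>L, ad\<^sup>R)\<close> of \<open>\<omega>(x, y)\<close>; modulo these the
  third becomes \<open>r\<^sub>z (l\<^sub>y + r\<^sub>y) = 0\<close>, which holds in \<open>\<Xi>(\<hh>)\<close> because \<open>l\<^sub>y + r\<^sub>y\<close> takes values
  in the left center. Hence an extension satisfying the center condition is the same thing as
  linear data with values in \<open>\<Xi>(\<hh>)\<close> subject to three identities
  (\<open>nonabelian_extension_iff_Xi\<close>).

  A morphism out of \<open>\<gg>\<close> unfolds to the same data: the degree one part of the source is zero, so
  every axiom involving it is void, \<open>f\<^sub>0\<close> and \<open>f\<^sub>2\<close> are \<open>(l, r)\<close> and \<open>\<omega>\<close>, the bracket axiom is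
  the pair of commutator identities and the coherence axiom is the cocycle identity
  (\<open>leibniz_2_morphism_iff_Xi\<close>).\<close>

section \<open>Linear data of an extension\<close>

text \<open>The linear data common to both sides of the correspondence, before any identity is
  imposed.\<close>

locale extension_data =
  G: leibniz_algebra sg bg + H: leibniz_algebra sh bh
  for sg :: "'k::field \<Rightarrow> 'g::ab_group_add \<Rightarrow> 'g" and bg :: "'g \<Rightarrow> 'g \<Rightarrow> 'g"
    and sh :: "'k \<Rightarrow> 'h::ab_group_add \<Rightarrow> 'h" and bh :: "'h \<Rightarrow> 'h \<Rightarrow> 'h" +
  fixes l r :: "'g \<Rightarrow> 'h \<Rightarrow> 'h" and \<omega> :: "'g \<Rightarrow> 'g \<Rightarrow> 'h"
  assumes linear_l: "linear_on sg UNIV (fun_scale sh) (gl sh) l"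
    and linear_r: "linear_on sg UNIV (fun_scale sh) (gl sh) r"
    and bilinear_\<omega>: "bilinear_on sg UNIV sg UNIV sh UNIV \<omega>"
begin

lemma gl_l: "l x \<in> gl sh" and gl_r: "r x \<in> gl sh"
  using linear_l linear_r by (auto simp: linear_on_def)

lemma add_simps:
  "l (x + y) \<alpha> = l x \<alpha> + l y \<alpha>" "l x (\<alpha> + \<beta>) = l x \<alpha> + l x \<beta>"
  "r (x + y) \<alpha> = r x \<alpha> + r y \<alpha>" "r x (\<alpha> + \<beta>) = r x \<alpha> + r x \<beta>"
  "\<omega> (x + y) z = \<omega> x z + \<omega> y z" "\<omega> x (y + z) = \<omega> x y + \<omega> x z"
  using linear_l linear_r bilinear_\<omega> gl_l[of x] gl_r[of x]
  by (auto simp: linear_on_def bilinear_on_def H.gl_iff)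

lemma scale_simps:
  "l (sg c x) \<alpha> = sh c (l x \<alpha>)" "l x (sh c \<alpha>) = sh c (l x \<alpha>)"
  "r (sg c x) \<alpha> = sh c (r x \<alpha>)" "r x (sh c \<alpha>) = sh c (r x \<alpha>)"
  "\<omega> (sg c x) z = sh c (\<omega> x z)" "\<omega> x (sg c z) = sh c (\<omega> x z)"
  using linear_l linear_r bilinear_\<omega> gl_l[of x] gl_r[of x]
  by (auto simp: linear_on_def bilinear_on_def H.gl_iff fun_scale_def)

lemma zero_simps:
  "l 0 \<alpha> = 0" "l x 0 = 0" "r 0 \<alpha> = 0" "r x 0 = 0" "\<omega> 0 y = 0" "\<omega> x 0 = 0"
  using add_simps(1)[of 0 0 \<alpha>] add_simps(2)[of x 0 0] add_simps(3)[of 0 0 \<alpha>]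
    add_simps(4)[of x 0 0] add_simps(5)[of 0 0 y] add_simps(6)[of x 0 0] by simp_all

lemma bilinear_ext_br:
  "bilinear_on (module_prod.scale sg sh) UNIV (module_prod.scale sg sh) UNIV
    (module_prod.scale sg sh) UNIV (ext_br bg bh l r \<omega>)"
proof -
  note sc = module_prod.scale_def[OF module_prod_vector_space
      [OF G.vector_space_axioms H.vector_space_axioms]]
  show ?thesis
    by (auto simp: bilinear_on_def linear_on_def ext_br_def split_beta sc add_simps scale_simps
        G.br_simps H.br_simps H.scale_right_distrib algebra_simps)
qed

section \<open>Extensions as data in \<open>\<Xi>(\<hh>)\<close>\<close>

text \<open>By trilinearity the Leibniz identity of the extension splits according to which arguments
  lie in \<open>\<gg>\<close> and which in \<open>\<hh>\<close>: three identities with two arguments in \<open>\<hh>\<close>, three with one, and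
  one with none.\<close>

lemma leibniz_ext_br_iff:
  "(\<forall>u v w. ext_br bg bh l r \<omega> u (ext_br bg bh l r \<omega> v w) =
      ext_br bg bh l r \<omega> (ext_br bg bh l r \<omega> u v) w + ext_br bg bh l r \<omega> v (ext_br bg bh l r \<omega> u w))
   \<longleftrightarrow>
    (\<forall>x \<beta> \<gamma>. l x (bh \<beta> \<gamma>) = bh (l x \<beta>) \<gamma> + bh \<beta> (l x \<gamma>)) \<and>
    (\<forall>y \<alpha> \<gamma>. bh \<alpha> (l y \<gamma>) = bh (r y \<alpha>) \<gamma> + l y (bh \<alpha> \<gamma>)) \<and>
    (\<forall>z \<alpha> \<beta>. bh \<alpha> (r z \<beta>) = r z (bh \<alpha> \<beta>) + bh \<beta> (r z \<alpha>)) \<and>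
    (\<forall>x y \<gamma>. l x (l y \<gamma>) = l (bg x y) \<gamma> + bh (\<omega> x y) \<gamma> + l y (l x \<gamma>)) \<and>
    (\<forall>x z \<beta>. l x (r z \<beta>) = r z (l x \<beta>) + r (bg x z) \<beta> + bh \<beta> (\<omega> x z)) \<and>
    (\<forall>y z \<alpha>. r (bg y z) \<alpha> + bh \<alpha> (\<omega> y z) = r z (r y \<alpha>) + l y (r z \<alpha>)) \<and>
    (\<forall>x y z. \<omega> x (bg y z) + l x (\<omega> y z) =
      \<omega> (bg x y) z + r z (\<omega> x y) + \<omega> y (bg x z) + l y (\<omega> x z))"
  (is "(\<forall>u v w. ?L u v w) \<longleftrightarrow> ?R")
proof
  assume L: "\<forall>u v w. ?L u v w"
  note E = L[rule_format, of "(x, \<alpha>)" "(y, \<beta>)" "(z, \<gamma>)" for x \<alpha> y \<beta> z \<gamma>]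
  note rules = ext_br_def zero_simps G.br_zero H.br_zero
  show ?R
  proof (intro conjI allI)
    show "l x (bh \<beta> \<gamma>) = bh (l x \<beta>) \<gamma> + bh \<beta> (l x \<gamma>)" for x \<beta> \<gamma>
      using E[of x 0 0 \<beta> 0 \<gamma>] by (simp add: rules)
    show "bh \<alpha> (l y \<gamma>) = bh (r y \<alpha>) \<gamma> + l y (bh \<alpha> \<gamma>)" for y \<alpha> \<gamma>
      using E[of 0 \<alpha> y 0 0 \<gamma>] by (simp add: rules)
    show "bh \<alpha> (r z \<beta>) = r z (bh \<alpha> \<beta>) + bh \<beta> (r z \<alpha>)" for z \<alpha> \<beta>
      using E[of 0 \<alpha> 0 \<beta> z 0] by (simp add: rules)
    show "l x (l y \<gamma>) = l (bg x y) \<gamma> + bh (\<omega> x y) \<gamma> + l y (l x \<gamma>)" for x y \<gamma>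
      using E[of x 0 y 0 0 \<gamma>] by (simp add: rules)
    show "l x (r z \<beta>) = r z (l x \<beta>) + r (bg x z) \<beta> + bh \<beta> (\<omega> x z)" for x z \<beta>
      using E[of x 0 0 \<beta> z 0] by (simp add: rules algebra_simps)
    show "r (bg y z) \<alpha> + bh \<alpha> (\<omega> y z) = r z (r y \<alpha>) + l y (r z \<alpha>)" for y z \<alpha>
      using E[of 0 \<alpha> y 0 z 0] by (simp add: rules)
    show "\<omega> x (bg y z) + l x (\<omega> y z) =
        \<omega> (bg x y) z + r z (\<omega> x y) + \<omega> y (bg x z) + l y (\<omega> x z)" for x y z
      using E[of x 0 y 0 z 0] by (simp add: rules algebra_simps)
  qed
next
  assume R: ?R
  \<comment> \<open>The identities are oriented so that rewriting terminates: \<open>l\<close> and \<open>r\<close> move inside brackets of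
    \<open>\<hh>\<close>, while brackets with a value of \<open>\<omega>\<close> and double applications of \<open>r\<close> are eliminated.\<close>
  note ids = R[THEN conjunct1] R[THEN conjunct2, THEN conjunct1]
    R[THEN conjunct2, THEN conjunct2, THEN conjunct1]
  note ids' = R[THEN conjunct2, THEN conjunct2, THEN conjunct2]
  have ghh: "l x (bh \<beta> \<gamma>) = bh (l x \<beta>) \<gamma> + bh \<beta> (l x \<gamma>)" for x \<beta> \<gamma>
    using ids(1) by (elim allE)
  have hgh: "bh (r y \<alpha>) \<gamma> = - bh (l y \<alpha>) \<gamma>" for y \<alpha> \<gamma>
  proof -
    have "bh \<alpha> (l y \<gamma>) = bh (r y \<alpha>) \<gamma> + l y (bh \<alpha> \<gamma>)" using ids(2) by (elim allE)
    then show ?thesis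
      by (simp only: ghh eq_neg_iff_add_eq_0) (simp add: add.assoc[symmetric])
  qed
  have hhg: "r z (bh \<alpha> \<beta>) = bh \<alpha> (r z \<beta>) - bh \<beta> (r z \<alpha>)" for z \<alpha> \<beta>
  proof -
    have "bh \<alpha> (r z \<beta>) = r z (bh \<alpha> \<beta>) + bh \<beta> (r z \<alpha>)" using ids(3) by (elim allE)
    then show ?thesis by (simp only: eq_diff_eq)
  qed
  have ggh: "bh (\<omega> x y) \<gamma> = l x (l y \<gamma>) - l (bg x y) \<gamma> - l y (l x \<gamma>)" for x y \<gamma>
  proof -
    have "l x (l y \<gamma>) = l (bg x y) \<gamma> + bh (\<omega> x y) \<gamma> + l y (l x \<gamma>)"
      using ids'[THEN conjunct1] by (elim allE)
    then show ?thesis by (simp add: algebra_simps)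
  qed
  have ghg: "bh \<beta> (\<omega> x z) = l x (r z \<beta>) - r z (l x \<beta>) - r (bg x z) \<beta>" for x z \<beta>
  proof -
    have "l x (r z \<beta>) = r z (l x \<beta>) + r (bg x z) \<beta> + bh \<beta> (\<omega> x z)"
      using ids'[THEN conjunct2, THEN conjunct1] by (elim allE)
    then show ?thesis by (simp add: algebra_simps)
  qed
  have hgg: "r z (r y \<alpha>) = - r z (l y \<alpha>)" for y z \<alpha>
  proof -
    have "r (bg y z) \<alpha> + bh \<alpha> (\<omega> y z) = r z (r y \<alpha>) + l y (r z \<alpha>)"
      using ids'[THEN conjunct2, THEN conjunct2, THEN conjunct1] by (elim allE)
    then show ?thesis by (simp add: ghg algebra_simps eq_neg_iff_add_eq_0)
  qed
  have ggg: "\<omega> (bg x y) z =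
      \<omega> x (bg y z) + l x (\<omega> y z) - r z (\<omega> x y) - \<omega> y (bg x z) - l y (\<omega> x z)" for x y z
  proof -
    have "\<omega> x (bg y z) + l x (\<omega> y z) =
        \<omega> (bg x y) z + r z (\<omega> x y) + \<omega> y (bg x z) + l y (\<omega> x z)"
      using ids'[THEN conjunct2, THEN conjunct2, THEN conjunct2] by (elim allE)
    then show ?thesis by (simp add: algebra_simps)
  qed
  show "\<forall>u v w. ?L u v w"
    by (auto simp: ext_br_def split_beta add_simps G.br_br H.br_br H.br_simps G.br_simps
        ghh hgh hhg ggh ghg hgg ggg algebra_simps)
qed

lemma nonabelian_extension_iff:
  "nonabelian_extension sg bg sh bh l r \<omega> \<longleftrightarrow>
    (\<forall>u v w. ext_br bg bh l r \<omega> u (ext_br bg bh l r \<omega> v w) =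
      ext_br bg bh l r \<omega> (ext_br bg bh l r \<omega> u v) w + ext_br bg bh l r \<omega> v (ext_br bg bh l r \<omega> u w))"
  using vector_space_module_prod[OF G.vector_space_axioms H.vector_space_axioms]
    G.leibniz_algebra_axioms H.leibniz_algebra_axioms linear_l linear_r bilinear_\<omega> bilinear_ext_br
  by (simp add: nonabelian_extension_def nonabelian_extension_axioms_def
      leibniz_algebra_def[of "module_prod.scale sg sh"]
      leibniz_algebra_axioms_def[of "module_prod.scale sg sh"])

text \<open>Bracketing \<open>\<alpha> \<in> \<hh>\<close> with \<open>y + \<beta>\<close> gives \<open>r\<^sub>y \<alpha> + [\<alpha>, \<beta>]\<close>, so \<open>\<alpha>\<close> is left central in the
  extension iff it is left central in \<open>\<hh>\<close> and killed by every \<open>r\<^sub>y\<close>.\<close>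

lemma left_center_ext_br_iff:
  "Pair 0 ` left_center bh = left_center (ext_br bg bh l r \<omega>) \<inter> range (Pair 0) \<longleftrightarrow>
    (\<forall>y. \<forall>\<alpha>\<in>left_center bh. r y \<alpha> = 0)"
proof -
  have "(0, \<alpha>) \<in> left_center (ext_br bg bh l r \<omega>) \<longleftrightarrow>
      \<alpha> \<in> left_center bh \<and> (\<forall>y. r y \<alpha> = 0)" (is "?E \<longleftrightarrow> ?H") for \<alpha>
  proof -
    have br: "ext_br bg bh l r \<omega> (0, \<alpha>) (y, \<beta>) = (0, r y \<alpha> + bh \<alpha> \<beta>)" for y \<beta>
      by (simp add: ext_br_def zero_simps G.br_zero)
    have "?E \<longleftrightarrow> (\<forall>y \<beta>. r y \<alpha> + bh \<alpha> \<beta> = 0)"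
      by (simp add: left_center_def br zero_prod_def)
    also have "\<dots> \<longleftrightarrow> ?H"
    proof
      assume A: "\<forall>y \<beta>. r y \<alpha> + bh \<alpha> \<beta> = 0"
      have "bh \<alpha> \<beta> = 0" for \<beta> using A[rule_format, of 0 \<beta>] by (simp add: zero_simps)
      moreover have "r y \<alpha> = 0" for y using A[rule_format, of y 0] by (simp add: H.br_zero)
      ultimately show ?H by (simp add: left_center_def)
    qed (simp add: left_center_def)
    finally show ?thesis .
  qed
  then show ?thesis by fast
qed

text \<open>In \<open>\<Xi>(\<hh>)\<close> the identity \<open>r\<^sub>z r\<^sub>y = - r\<^sub>z l\<^sub>y\<close> is automatic. This makes the mixed identity
  with its first argument in \<open>\<hh>\<close> and the other two in \<open>\<gg>\<close> a consequence of the commutator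
  identity for \<open>l\<close> and \<open>r\<close>, so that only three identities remain.\<close>

lemma nonabelian_extension_iff_Xi:
  "nonabelian_extension sg bg sh bh l r \<omega> \<and>
    Pair 0 ` left_center bh = left_center (ext_br bg bh l r \<omega>) \<inter> range (Pair 0) \<longleftrightarrow>
    (\<forall>x. (l x, r x) \<in> Xi sh bh) \<and>
    (\<forall>x y \<gamma>. l x (l y \<gamma>) = l (bg x y) \<gamma> + bh (\<omega> x y) \<gamma> + l y (l x \<gamma>)) \<and>
    (\<forall>x z \<beta>. l x (r z \<beta>) = r z (l x \<beta>) + r (bg x z) \<beta> + bh \<beta> (\<omega> x z)) \<and>
    (\<forall>x y z. \<omega> x (bg y z) + l x (\<omega> y z) =
      \<omega> (bg x y) z + r z (\<omega> x y) + \<omega> y (bg x z) + l y (\<omega> x z))"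
  (is "_ \<longleftrightarrow> ?Xi \<and> ?ggh \<and> ?ghg \<and> ?ggg")
proof -
  let ?ghh = "\<forall>x \<beta> \<gamma>. l x (bh \<beta> \<gamma>) = bh (l x \<beta>) \<gamma> + bh \<beta> (l x \<gamma>)"
  let ?hgh = "\<forall>y \<alpha> \<gamma>. bh \<alpha> (l y \<gamma>) = bh (r y \<alpha>) \<gamma> + l y (bh \<alpha> \<gamma>)"
  let ?hhg = "\<forall>z \<alpha> \<beta>. bh \<alpha> (r z \<beta>) = r z (bh \<alpha> \<beta>) + bh \<beta> (r z \<alpha>)"
  let ?hgg = "\<forall>y z \<alpha>. r (bg y z) \<alpha> + bh \<alpha> (\<omega> y z) = r z (r y \<alpha>) + l y (r z \<alpha>)"
  have Xi: "?Xi \<longleftrightarrow> ?ghh \<and> ?hgh \<and> ?hhg \<and> (\<forall>y. \<forall>\<alpha>\<in>left_center bh. r y \<alpha> = 0)"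
  proof -
    \<comment> \<open>Given that \<open>l\<^sub>y\<close> is a derivation, the second identity says that \<open>l\<^sub>y + r\<^sub>y\<close> is left central.\<close>
    have anti: "?hgh \<longleftrightarrow> (\<forall>y \<alpha> \<gamma>. bh (r y \<alpha>) \<gamma> = - bh (l y \<alpha>) \<gamma>)" if ?ghh
    proof -
      have "bh \<alpha> (l y \<gamma>) = bh (r y \<alpha>) \<gamma> + l y (bh \<alpha> \<gamma>) \<longleftrightarrow>
          bh (r y \<alpha>) \<gamma> = - bh (l y \<alpha>) \<gamma>" for y \<alpha> \<gamma>
        unfolding that[rule_format] eq_neg_iff_add_eq_0 by (simp add: add.assoc[symmetric])
      then show ?thesis by presburger
    qed
    have derR: "r z (bh \<alpha> \<beta>) = bh \<alpha> (r z \<beta>) - bh \<beta> (r z \<alpha>) \<longleftrightarrow>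
        bh \<alpha> (r z \<beta>) = r z (bh \<alpha> \<beta>) + bh \<beta> (r z \<alpha>)" for z \<alpha> \<beta>
      by (simp only: eq_diff_eq) (rule eq_commute)
    have "?Xi \<longleftrightarrow> ?ghh \<and> ?hhg \<and> (\<forall>y \<alpha> \<gamma>. bh (r y \<alpha>) \<gamma> = - bh (l y \<alpha>) \<gamma>) \<and>
        (\<forall>y. \<forall>\<alpha>\<in>left_center bh. r y \<alpha> = 0)"
      by (simp only: H.Xi_iff fst_conv snd_conv gl_l gl_r simp_thms derR all_conj_distrib
          left_center_def Ball_def mem_Collect_eq)
    then show ?thesis using anti by argo
  qed
  have hgg: ?hgg if ?Xi ?ghg
  proof (intro allI)
    fix y z \<alpha>
    have "r z (r y \<alpha>) = - r z (l y \<alpha>)"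
      using H.Xi_snd_sum[of "(l y, r y)" "(l z, r z)"] that(1) by simp
    then show "r (bg y z) \<alpha> + bh \<alpha> (\<omega> y z) = r z (r y \<alpha>) + l y (r z \<alpha>)"
      using that(2) by simp
  qed
  show ?thesis
    unfolding nonabelian_extension_iff leibniz_ext_br_iff left_center_ext_br_iff
    using Xi hgg by argo
qed

section \<open>Morphisms as data in \<open>\<Xi>(\<hh>)\<close>\<close>

lemma linear_pair:
  assumes "\<forall>x. (l x, r x) \<in> Xi sh bh"
  shows "linear_on sg UNIV (module_prod.scale (fun_scale sh) (fun_scale sh)) (Xi sh bh)
    (\<lambda>x. (l x, r x))"
proof -
  note vf = vector_space_fun_scale[OF H.vector_space_axioms]
  show ?thesis
    using assms
    by (simp add: linear_on_def module_prod.scale_def[OF module_prod_vector_space[OF vf vf]]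
        fun_eq_iff fun_scale_def add_simps scale_simps)
qed

text \<open>The degree one part of the source is \<open>{0}\<close>, so \<open>f1\<close> only has to send \<open>0\<close> to \<open>0\<close>. The
  bracket axiom is an equation of pairs of maps, hence two pointwise identities.\<close>

lemma leibniz_2_morphism_iff_Xi:
  "leibniz_2_morphism (alg_two_alg sg bg) (Xi_two_alg sh bh) (\<lambda>x. (l x, r x)) f1 \<omega> \<longleftrightarrow>
    f1 0 = 0 \<and> (\<forall>x. (l x, r x) \<in> Xi sh bh) \<and>
    (\<forall>x y \<gamma>. l x (l y \<gamma>) = l (bg x y) \<gamma> + bh (\<omega> x y) \<gamma> + l y (l x \<gamma>)) \<and>
    (\<forall>x z \<beta>. l x (r z \<beta>) = r z (l x \<beta>) + r (bg x z) \<beta> + bh \<beta> (\<omega> x z)) \<and>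
    (\<forall>x y z. \<omega> x (bg y z) + l x (\<omega> y z) =
      \<omega> (bg x y) z + r z (\<omega> x y) + \<omega> y (bg x z) + l y (\<omega> x z))"
  (is "?M \<longleftrightarrow> _ = _ \<and> ?Xi \<and> ?ggh \<and> ?ghg \<and> ?ggg")
proof -
  have two_algs: "leibniz_2_algebra (alg_two_alg sg bg)" "leibniz_2_algebra (Xi_two_alg sh bh)"
    using G.strict_leibniz_2_algebra_alg_two_alg H.strict_leibniz_2_algebra_Xi
    by (simp_all add: strict_leibniz_2_algebra_def)
  have bracket: "der_br (l x, r x) (l y, r y) - (l (bg x y), r (bg x y))
        = (adL bh (\<omega> x y), adR bh (\<omega> x y)) \<longleftrightarrow>
      (\<forall>\<gamma>. l x (l y \<gamma>) = l (bg x y) \<gamma> + bh (\<omega> x y) \<gamma> + l y (l x \<gamma>)) \<and>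
      (\<forall>\<beta>. l x (r y \<beta>) = r y (l x \<beta>) + r (bg x y) \<beta> + bh \<beta> (\<omega> x y))" for x y
    by (simp add: der_br_def commutator_def adL_def adR_def fun_eq_iff diff_eq_eq algebra_simps)
  have cocycle: "l x (\<omega> y z) - l y (\<omega> x z) - r z (\<omega> x y) - \<omega> (bg x y) z + \<omega> x (bg y z)
        - \<omega> y (bg x z) = 0 \<longleftrightarrow>
      \<omega> x (bg y z) + l x (\<omega> y z) =
        \<omega> (bg x y) z + r z (\<omega> x y) + \<omega> y (bg x z) + l y (\<omega> x z)" for x y z
    by (subst eq_iff_diff_eq_0[of "\<omega> x (bg y z) + l x (\<omega> y z)"]) (simp add: algebra_simps)
  have ad_zero: "(0, 0) = (adL bh 0, adR bh 0)"
    by (simp add: adL_def adR_def H.br_zero fun_eq_iff)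
  have linear_f1: "linear_on sg {0} sh UNIV f1 \<longleftrightarrow> f1 0 = 0"
    by (auto simp: linear_on_def)
  have linear_f0: "linear_on sg UNIV (module_prod.scale (fun_scale sh) (fun_scale sh)) (Xi sh bh)
      (\<lambda>x. (l x, r x)) \<longleftrightarrow> ?Xi"
    using linear_pair by (auto simp: linear_on_def)
  have at_zero: "l 0 = 0" "r 0 = 0"
    by (simp_all add: fun_eq_iff zero_simps)
  have "?M \<longleftrightarrow> f1 0 = 0 \<and> ?Xi \<and>
      (\<forall>x y. der_br (l x, r x) (l y, r y) - (l (bg x y), r (bg x y))
        = (adL bh (\<omega> x y), adR bh (\<omega> x y))) \<and>
      (\<forall>x y z. l x (\<omega> y z) - l y (\<omega> x z) - r z (\<omega> x y) - \<omega> (bg x y) z + \<omega> x (bg y z)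
        - \<omega> y (bg x z) = 0)"
    using two_algs bilinear_\<omega>
    by (auto simp: leibniz_2_morphism_def leibniz_2_morphism_axioms_def alg_two_alg_def
        Xi_two_alg_def linear_f0 linear_f1 ad_zero at_zero zero_simps)
  also have "\<dots> \<longleftrightarrow> f1 0 = 0 \<and> ?Xi \<and> ?ggh \<and> ?ghg \<and> ?ggg"
    unfolding bracket cocycle by blast
  finally show ?thesis .
qed

end

section \<open>The correspondence\<close>

lemma (in nonabelian_extension) extension_data: "extension_data sg bg sh bh l r \<omega>"
  using linear_l linear_r bilinear_\<omega> by unfold_locales

lemma extension_data_of_morphism:
  assumes "leibniz_algebra sg bg" and "leibniz_algebra sh bh"
    and "leibniz_2_morphism (alg_two_alg sg bg) (Xi_two_alg sh bh) f0 f1 f2"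
  shows "extension_data sg bg sh bh (\<lambda>x. Pr_L (f0 x)) (\<lambda>x. Pr_R (f0 x)) f2"
proof -
  interpret H: leibniz_algebra sh bh by fact
  note vf = vector_space_fun_scale[OF H.vector_space_axioms]
  note sc = module_prod.scale_def[OF module_prod_vector_space[OF vf vf]]
  have "linear_on sg UNIV (module_prod.scale (fun_scale sh) (fun_scale sh)) (Xi sh bh) f0"
    and "bilinear_on sg UNIV sg UNIV sh UNIV f2"
    using leibniz_2_morphism.linear_f0[OF assms(3)] leibniz_2_morphism.bilinear_f2[OF assms(3)]
    by (simp_all add: alg_two_alg_def Xi_two_alg_def)
  then show ?thesis
    using assms(1,2)
    by (auto simp: extension_data_def extension_data_axioms_def linear_on_def sc H.Xi_iff)
qed

theorem theorem3p12:
  fixes sg :: "'k::field \<Rightarrow> 'g::ab_group_add \<Rightarrow> 'g" and bg :: "'g \<Rightarrow> 'g \<Rightarrow> 'g"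
    and sh :: "'k \<Rightarrow> 'h::ab_group_add \<Rightarrow> 'h" and bh :: "'h \<Rightarrow> 'h \<Rightarrow> 'h"
  assumes "leibniz_algebra sg bg" and "leibniz_algebra sh bh"
  shows
    "(\<forall>(l :: 'g \<Rightarrow> 'h \<Rightarrow> 'h) (r :: 'g \<Rightarrow> 'h \<Rightarrow> 'h) (\<omega> :: 'g \<Rightarrow> 'g \<Rightarrow> 'h).
        nonabelian_extension sg bg sh bh l r \<omega> \<and>
        Pair 0 ` left_center bh = left_center (ext_br bg bh l r \<omega>) \<inter> range (Pair 0) \<longrightarrow>
        leibniz_2_morphism (alg_two_alg sg bg) (Xi_two_alg sh bh)
          (\<lambda>x. (l x, r x)) (\<lambda>_. 0) (\<lambda>x y. \<omega> x y)) \<and>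
     (\<forall>(f0 :: 'g \<Rightarrow> ('h \<Rightarrow> 'h) \<times> ('h \<Rightarrow> 'h)) (f1 :: 'g \<Rightarrow> 'h) (f2 :: 'g \<Rightarrow> 'g \<Rightarrow> 'h).
        leibniz_2_morphism (alg_two_alg sg bg) (Xi_two_alg sh bh) f0 f1 f2 \<longrightarrow>
        (\<exists>l r \<omega>.
          (\<forall>x. l x = Pr_L (f0 x)) \<and> (\<forall>x. r x = Pr_R (f0 x)) \<and> (\<forall>x y. \<omega> x y = f2 x y) \<and>
          nonabelian_extension sg bg sh bh l r \<omega> \<and>
          Pair 0 ` left_center bh = left_center (ext_br bg bh l r \<omega>) \<inter> range (Pair 0)))"
proof (intro conjI allI impI)
  fix l r :: "'g \<Rightarrow> 'h \<Rightarrow> 'h" and \<omega> :: "'g \<Rightarrow> 'g \<Rightarrow> 'h"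
  assume ext: "nonabelian_extension sg bg sh bh l r \<omega> \<and>
    Pair 0 ` left_center bh = left_center (ext_br bg bh l r \<omega>) \<inter> range (Pair 0)"
  interpret extension_data sg bg sh bh l r \<omega>
    by (rule nonabelian_extension.extension_data[OF conjunct1[OF ext]])
  show "leibniz_2_morphism (alg_two_alg sg bg) (Xi_two_alg sh bh)
      (\<lambda>x. (l x, r x)) (\<lambda>_. 0) (\<lambda>x y. \<omega> x y)"
    unfolding leibniz_2_morphism_iff_Xi
    by (rule conjI[OF refl ext[unfolded nonabelian_extension_iff_Xi]])
next
  fix f0 :: "'g \<Rightarrow> ('h \<Rightarrow> 'h) \<times> ('h \<Rightarrow> 'h)" and f1 :: "'g \<Rightarrow> 'h" and f2 :: "'g \<Rightarrow> 'g \<Rightarrow> 'h"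
  assume mor: "leibniz_2_morphism (alg_two_alg sg bg) (Xi_two_alg sh bh) f0 f1 f2"
  let ?l = "\<lambda>x. Pr_L (f0 x)" and ?r = "\<lambda>x. Pr_R (f0 x)"
  interpret extension_data sg bg sh bh ?l ?r f2
    using extension_data_of_morphism[OF assms mor] .
  have pair: "leibniz_2_morphism (alg_two_alg sg bg) (Xi_two_alg sh bh)
      (\<lambda>x. (?l x, ?r x)) f1 f2"
    using mor by simp
  have "nonabelian_extension sg bg sh bh ?l ?r f2 \<and>
    Pair 0 ` left_center bh = left_center (ext_br bg bh ?l ?r f2) \<inter> range (Pair 0)"
    unfolding nonabelian_extension_iff_Xi
    by (rule conjunct2[OF pair[unfolded leibniz_2_morphism_iff_Xi]])
  then show "\<exists>l r \<omega>.
      (\<forall>x. l x = Pr_L (f0 x)) \<and> (\<forall>x. r x = Pr_R (f0 x)) \<and> (\<forall>x y. \<omega> x y = f2 x y) \<and>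
      nonabelian_extension sg bg sh bh l r \<omega> \<and>
      Pair 0 ` left_center bh = left_center (ext_br bg bh l r \<omega>) \<inter> range (Pair 0)"
    by (intro exI[of _ ?l] exI[of _ ?r] exI[of _ f2] conjI[OF allI[OF refl]]
        conjI[OF allI[OF allI[OF refl]]])
qed

end
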